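(* Consider a college admissions problem with a common strict priority order $\triangleright$ induced by scores, and let $T\ge1$. Suppose that all students follow straightforward strategies in the $T$-round time-constrained dynamic mechanism (TCDM), with final matching $\mu^{TCDM}$, and let $\mu^{DA}$ be the outcome of student-proposing deferred acceptance (DA) under truthful reports. If a student $i\in I$ (strictly) prefers her assignment under TCDM to her assignment under DA, i.e. $\mu^{TCDM}(i)\succ_i\mu^{DA}(i)$, then there exists a student $j\in I$ with higher priority, $j\triangleright i$, who is unassigned under TCDM, i.e. $\mu^{TCDM}(j)=\emptyset$.
   Context: Problem. $I$ is a finite set of students and $C$ a finite set of colleges. Each student $i$ has a strict preference (linear order) $\succ_i$ over $C\cup\{\emptyset\}$, where $\emptyset$ is the outside option (being unassigned); $c$ is acceptable to $i$ if $c\succ_i\emptyset$. Each college $c$ has capacity $q_c\in\mathbb{N}_+$. Each student has a score $s_i>0$, scores are distinct, and every college uses the common strict priority order $i\triangleright j\iff s_i>s_j$. A matching is a map $\mu:I\to C\cup\{\emptyset\}$ with $|\mu^{-1}(c)|\le q_c$ for all $c$. The cutoff of $c$ at $\mu$ is $f_c(\mu)=\min\{s_i:i\in\mu^{-1}(c)\}$ if $|\mu^{-1}(c)|=q_c$, and $f_c(\mu)=0$ otherwise. DA (student-proposing deferred acceptance). Step 1: each student applies to her most-preferred acceptable college (if any); each college tentatively holds its highest-priority applicants up to capacity and rejects the rest. Each later step: every student rejected in the preceding step applies to her next most-preferred acceptable college (if any); each college holds the highest-priority students up to capacity among those it was holding and its new applicants, and rejects the rest. It ends when no further rejection occurs;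 tentative acceptances become final and all other students are unassigned. TCDM. In each round $t=1,\dots,T$ every student chooses one element of $C\cup\{\emptyset\}$ (replacing any earlier application). Given the current application profile, each college tentatively holds its highest-priority current applicants up to capacity and rejects the others; this defines the tentative matching $\mu^t$ (students who are rejected or chose $\emptyset$ are unassigned). The final matching is $\mu^T$. Straightforward strategy. In round 1 student $i$ applies to her $\succ_i$-best element of $C\cup\{\emptyset\}$. In round $t>1$: if $\mu^{t-1}(i)\in C$, she applies again to $\mu^{t-1}(i)$; if $\mu^{t-1}(i)=\emptyset$, she chooses her $\succ_i$-best element of $\{c\in C: s_i\ge f_c(\mu^{t-1})\}\cup\{\emptyset\}$. *)

theory Defs
  imports Complex_Main
begin

text \<open>
  The outside option is \<open>None\<close>, so a college or the outside option is an element of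
  \<open>'c option\<close>. A pair \<open>(x, y) \<in> P i\<close> means that student \<open>i\<close> strictly prefers \<open>x\<close> to \<open>y\<close>.
\<close>

definition alternatives :: "'c set \<Rightarrow> 'c option set" where
  "alternatives C = insert None (Some ` C)"

locale college_admissions =
  fixes I :: "'i set"
    and C :: "'c set"
    and P :: "'i \<Rightarrow> 'c option rel"
    and q :: "'c \<Rightarrow> nat"
    and s :: "'i \<Rightarrow> real"
  assumes finite_students: "finite I"
    and finite_colleges: "finite C"
    and pref_subset: "\<And>i. i \<in> I \<Longrightarrow> P i \<subseteq> alternatives C \<times> alternatives C"
    and pref_linear: "\<And>i. i \<in> I \<Longrightarrow> strict_linear_order_on (alternatives C) (P i)"
    and capacity_pos: "\<And>c. c \<in> C \<Longrightarrow> q c > 0"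
    and score_pos: "\<And>i. i \<in> I \<Longrightarrow> s i > 0"
    and score_inj: "inj_on s I"

definition higher_priority :: "('i \<Rightarrow> real) \<Rightarrow> 'i \<Rightarrow> 'i \<Rightarrow> bool" where
  "higher_priority s i j \<longleftrightarrow> s i > s j"

definition acceptable :: "'c set \<Rightarrow> 'c option rel \<Rightarrow> 'c set" where
  "acceptable C R = {c \<in> C. (Some c, None) \<in> R}"

definition best :: "'c option rel \<Rightarrow> 'c option set \<Rightarrow> 'c option" where
  "best R S = (THE x. x \<in> S \<and> (\<forall>y\<in>S. y \<noteq> x \<longrightarrow> (x, y) \<in> R))"

type_synonym ('i, 'c) assignment = "'i \<Rightarrow> 'c option"

definition assigned :: "'i set \<Rightarrow> ('i, 'c) assignment \<Rightarrow> 'c \<Rightarrow> 'i set" where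
  "assigned I \<mu> c = {i \<in> I. \<mu> i = Some c}"

definition cutoff ::
  "'i set \<Rightarrow> ('c \<Rightarrow> nat) \<Rightarrow> ('i \<Rightarrow> real) \<Rightarrow> ('i, 'c) assignment \<Rightarrow> 'c \<Rightarrow> real" where
  "cutoff I q s \<mu> c = (if card (assigned I \<mu> c) = q c then Min (s ` assigned I \<mu> c) else 0)"

text \<open>The (at most) \<open>n\<close> highest-priority students of a finite set \<open>X\<close>.\<close>

definition top_students :: "('i \<Rightarrow> real) \<Rightarrow> nat \<Rightarrow> 'i set \<Rightarrow> 'i set" where
  "top_students s n X = {i \<in> X. card {j \<in> X. higher_priority s j i} < n}"

text \<open>
  The tentative assignment when the students apply according to \<open>a\<close>. Here \<open>assigned I a c\<close> is
  the set of applicants to \<open>c\<close>.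
\<close>

definition tentative ::
  "'i set \<Rightarrow> ('c \<Rightarrow> nat) \<Rightarrow> ('i \<Rightarrow> real) \<Rightarrow> ('i, 'c) assignment \<Rightarrow> ('i, 'c) assignment" where
  "tentative I q s a = (\<lambda>i. case a i of
      None \<Rightarrow> None
    | Some c \<Rightarrow> if i \<in> top_students s (q c) (assigned I a c) then Some c else None)"

subsection \<open>Deferred acceptance\<close>

text \<open>
  A state records the set of colleges to which each student has applied so far and the tentative
  assignment. A student who is not held by a college applies to her best acceptable college among
  those she has not yet applied to. As she applies again directly after each rejection, the
  students making a new application in a step after the first are exactly those rejected in the
  preceding step whose list is not exhausted. A student who is held counts as applying to the
  college that holds her.
\<close>

type_synonym ('i, 'c) da_state = "('i \<Rightarrow> 'c set) \<times> ('i, 'c) assignment"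

definition next_college :: "'c set \<Rightarrow> 'c option rel \<Rightarrow> 'c set \<Rightarrow> 'c option" where
  "next_college C R A =
    (if acceptable C R - A = {} then None else best R (Some ` (acceptable C R - A)))"

definition da_apps ::
  "'c set \<Rightarrow> ('i \<Rightarrow> 'c option rel) \<Rightarrow> ('i, 'c) da_state \<Rightarrow> ('i, 'c) assignment" where
  "da_apps C P st = (\<lambda>i. case snd st i of
      Some c \<Rightarrow> Some c
    | None \<Rightarrow> next_college C (P i) (fst st i))"

definition da_step ::
  "'i set \<Rightarrow> 'c set \<Rightarrow> ('i \<Rightarrow> 'c option rel) \<Rightarrow> ('c \<Rightarrow> nat) \<Rightarrow> ('i \<Rightarrow> real)
    \<Rightarrow> ('i, 'c) da_state \<Rightarrow> ('i, 'c) da_state" where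
  "da_step I C P q s st =
    (\<lambda>i. fst st i \<union> set_option (da_apps C P st i), tentative I q s (da_apps C P st))"

text \<open>The state at the end of step \<open>n\<close>; before step 1 there are no applications.\<close>

definition da_state ::
  "'i set \<Rightarrow> 'c set \<Rightarrow> ('i \<Rightarrow> 'c option rel) \<Rightarrow> ('c \<Rightarrow> nat) \<Rightarrow> ('i \<Rightarrow> real)
    \<Rightarrow> nat \<Rightarrow> ('i, 'c) da_state" where
  "da_state I C P q s n = (da_step I C P q s ^^ n) (\<lambda>_. {}, \<lambda>_. None)"

text \<open>No student is rejected in step \<open>n\<close> (for \<open>n \<ge> 1\<close>).\<close>

definition da_no_rejection ::
  "'i set \<Rightarrow> 'c set \<Rightarrow> ('i \<Rightarrow> 'c option rel) \<Rightarrow> ('c \<Rightarrow> nat) \<Rightarrow> ('i \<Rightarrow> real) \<Rightarrow> nat \<Rightarrow> bool" where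
  "da_no_rejection I C P q s n \<longleftrightarrow>
    (\<forall>i\<in>I. snd (da_state I C P q s n) i = da_apps C P (da_state I C P q s (n - 1)) i)"

definition DA ::
  "'i set \<Rightarrow> 'c set \<Rightarrow> ('i \<Rightarrow> 'c option rel) \<Rightarrow> ('c \<Rightarrow> nat) \<Rightarrow> ('i \<Rightarrow> real)
    \<Rightarrow> ('i, 'c) assignment" where
  "DA I C P q s =
    snd (da_state I C P q s (LEAST n. n \<ge> 1 \<and> da_no_rejection I C P q s n))"

subsection \<open>The time-constrained dynamic mechanism\<close>

text \<open>
  A strategy determines the next application from the tentative assignments of all previous
  rounds, most recent round first; \<open>tcdm_history\<close> lists the tentative assignments of the first
  \<open>t\<close> rounds in the same order.
\<close>

type_synonym ('i, 'c) strategy = "('i, 'c) assignment list \<Rightarrow> 'c option"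

fun tcdm_history ::
  "'i set \<Rightarrow> ('c \<Rightarrow> nat) \<Rightarrow> ('i \<Rightarrow> real) \<Rightarrow> ('i \<Rightarrow> ('i, 'c) strategy) \<Rightarrow> nat
    \<Rightarrow> ('i, 'c) assignment list" where
  "tcdm_history I q s \<sigma> 0 = []"
| "tcdm_history I q s \<sigma> (Suc t) =
    tentative I q s (\<lambda>i. \<sigma> i (tcdm_history I q s \<sigma> t)) # tcdm_history I q s \<sigma> t"

text \<open>The final assignment after \<open>T \<ge> 1\<close> rounds.\<close>

definition TCDM ::
  "'i set \<Rightarrow> ('c \<Rightarrow> nat) \<Rightarrow> ('i \<Rightarrow> real) \<Rightarrow> nat \<Rightarrow> ('i \<Rightarrow> ('i, 'c) strategy)
    \<Rightarrow> ('i, 'c) assignment" where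
  "TCDM I q s T \<sigma> = hd (tcdm_history I q s \<sigma> T)"

definition straightforward ::
  "'i set \<Rightarrow> 'c set \<Rightarrow> ('i \<Rightarrow> 'c option rel) \<Rightarrow> ('c \<Rightarrow> nat) \<Rightarrow> ('i \<Rightarrow> real)
    \<Rightarrow> 'i \<Rightarrow> ('i, 'c) strategy" where
  "straightforward I C P q s i h = (case h of
      [] \<Rightarrow> best (P i) (alternatives C)
    | \<mu> # _ \<Rightarrow> (case \<mu> i of
        Some c \<Rightarrow> Some c
      | None \<Rightarrow> best (P i) (alternatives {c \<in> C. s i \<ge> cutoff I q s \<mu> c})))"

end

theory Submission
  imports Defs
begin

text \<open>
  Say that college \<open>c\<close> is full above score \<open>x\<close> if it holds at least \<open>q c\<close> students with scores
  above \<open>x\<close>. In both mechanisms a held student keeps applying to her college, so a college that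
  is full above \<open>x\<close> stays so. Hence under DA every college that a student prefers to her assignment
  is full above her score, and under the straightforward strategies the same holds at every round
  for each student who is currently assigned. If all students ranked above \<open>i\<close> are assigned under
  TCDM, then induction down the scores shows that both mechanisms assign these students alike.
  So the same colleges are full above \<open>s i\<close> in both outcomes, and a college assigned to \<open>i\<close> under
  TCDM but preferred to her DA assignment would have to be full above her own score.
\<close>

section \<open>Colleges filled above a score\<close>

definition full_above ::
  "'i set \<Rightarrow> ('c \<Rightarrow> nat) \<Rightarrow> ('i \<Rightarrow> real) \<Rightarrow> ('i, 'c) assignment \<Rightarrow> 'c \<Rightarrow> real \<Rightarrow> bool" where
  "full_above I q s \<mu> c x \<longleftrightarrow> q c \<le> card {j \<in> assigned I \<mu> c. x < s j}"

lemma full_above_cong: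
  assumes "\<And>j. j \<in> I \<Longrightarrow> x < s j \<Longrightarrow> \<mu> j = \<nu> j"
  shows "full_above I q s \<mu> c x \<longleftrightarrow> full_above I q s \<nu> c x"
proof -
  have "{j \<in> assigned I \<mu> c. x < s j} = {j \<in> assigned I \<nu> c. x < s j}"
    using assms by (auto simp: assigned_def)
  then show ?thesis by (simp add: full_above_def)
qed

lemma full_above_mono:
  assumes "finite I" "full_above I q s \<mu> c x"
    and "\<And>j. j \<in> I \<Longrightarrow> \<mu> j = Some c \<Longrightarrow> \<nu> j = Some c"
  shows "full_above I q s \<nu> c x"
proof -
  have "card {j \<in> assigned I \<mu> c. x < s j} \<le> card {j \<in> assigned I \<nu> c. x < s j}"
    using assms by (intro card_mono) (auto simp: assigned_def)
  then show ?thesis using assms(2) by (simp add: full_above_def)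
qed

text \<open>Positivity of \<open>x\<close> excludes the default cutoff \<open>0\<close>, so
  \<open>c\<close> holds exactly \<open>q c\<close> students, all scoring above
  \<open>x\<close>.\<close>

lemma full_above_if_less_cutoff:
  assumes "finite I" "0 < x" "x < cutoff I q s \<mu> c"
  shows "full_above I q s \<mu> c x"
proof -
  have card: "card (assigned I \<mu> c) = q c" and less: "x < Min (s ` assigned I \<mu> c)"
    using assms(2,3) by (auto simp: cutoff_def split: if_splits)
  have fin: "finite (assigned I \<mu> c)"
    using assms(1) by (simp add: assigned_def)
  have "x < s j" if "j \<in> assigned I \<mu> c" for j
    using less that fin by (meson Min_le finite_imageI imageI less_le_trans)
  then have "{j \<in> assigned I \<mu> c. x < s j} = assigned I \<mu> c"
    by blast
  then show ?thesis using card by (simp add: full_above_def)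
qed

text \<open>If some member of \<open>X\<close> above \<open>x\<close> is left out, let
  \<open>i\<close> be the highest-scoring such one: everyone in \<open>X\<close> above
  \<open>i\<close> is chosen, and there are at least \<open>n\<close> of them because
  \<open>i\<close> was left out.\<close>

lemma top_students_above:
  assumes "finite X" "n \<le> card {j \<in> X. x < s j}"
  shows "n \<le> card {j \<in> top_students s n X. x < s j}"
proof (cases "{j \<in> X. x < s j} \<subseteq> top_students s n X")
  case True
  then have "{j \<in> top_students s n X. x < s j} = {j \<in> X. x < s j}"
    by (auto simp: top_students_def)
  then show ?thesis using assms(2) by simp
next
  case False
  define B where "B = {j \<in> X. x < s j} - top_students s n X"
  have B: "finite B" "B \<noteq> {}"
    using False assms(1) by (auto simp: B_def)
  obtain i where "i \<in> B" "\<And>j. j \<in> B \<Longrightarrow> s j \<le> s i"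
    using obtains_MAX[OF B, of s] B(1) by (metis Max_ge finite_imageI imageI)
  then have i: "i \<in> X" "x < s i" "i \<notin> top_students s n X"
    and "{j \<in> X. s i < s j} \<subseteq> {j \<in> top_students s n X. x < s j}"
    by (force simp: B_def)+
  then have "card {j \<in> X. s i < s j} \<le> card {j \<in> top_students s n X. x < s j}"
    using assms(1) by (intro card_mono) (auto simp: top_students_def)
  moreover have "n \<le> card {j \<in> X. s i < s j}"
    using i by (auto simp: top_students_def higher_priority_def)
  ultimately show ?thesis by linarith
qed

lemma assigned_tentative:
  "assigned I (tentative I q s a) c = top_students s (q c) (assigned I a c)"
  by (auto simp: assigned_def tentative_def top_students_def split: option.splits if_splits)

lemma tentative_SomeD: "tentative I q s a i = Some c \<Longrightarrow> a i = Some c"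
  by (auto simp: tentative_def split: option.splits if_splits)

lemma full_above_tentative:
  assumes "finite I" "full_above I q s a c x"
  shows "full_above I q s (tentative I q s a) c x"
proof -
  have "finite (assigned I a c)"
    using assms(1) by (simp add: assigned_def)
  then show ?thesis
    using assms(2) top_students_above by (auto simp: full_above_def assigned_tentative)
qed

text \<open>A rejected applicant is outscored by at least \<open>q c\<close> applicants, and
  selection keeps enough of them.\<close>

lemma full_above_if_rejected:
  assumes "finite I" "i \<in> I" "a i = Some c" "tentative I q s a i \<noteq> Some c"
  shows "full_above I q s (tentative I q s a) c (s i)"
proof -
  have "i \<in> assigned I a c" "i \<notin> top_students s (q c) (assigned I a c)"
    using assms by (auto simp: tentative_def assigned_def)
  then show ?thesis
    using assms(1) by (intro full_above_tentative)
      (auto simp: top_students_def full_above_def higher_priority_def)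
qed

text \<open>Fewer than \<open>q c\<close> applicants outscore a held student, and a college holds
  only applicants.\<close>

lemma not_full_above_if_held:
  assumes "finite I" "tentative I q s a i = Some c"
  shows "\<not> full_above I q s (tentative I q s a) c (s i)"
proof -
  have "i \<in> top_students s (q c) (assigned I a c)"
    using assms(2) by (auto simp: tentative_def split: option.splits if_splits)
  then have "card {j \<in> assigned I a c. s i < s j} < q c"
    by (simp add: top_students_def higher_priority_def)
  moreover have "card {j \<in> top_students s (q c) (assigned I a c). s i < s j}
      \<le> card {j \<in> assigned I a c. s i < s j}"
    using assms(1) by (intro card_mono) (auto simp: top_students_def assigned_def)
  ultimately show ?thesis
    by (simp add: full_above_def assigned_tentative)
qed

context college_admissions
begin

section \<open>Strict preferences and best elements\<close>

lemma pref_asym: "i \<in> I \<Longrightarrow> (x, y) \<in> P i \<Longrightarrow> (y, x) \<notin> P i"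
  using pref_linear[of i] unfolding strict_linear_order_on_def trans_def irrefl_def by blast

lemma pref_trans: "i \<in> I \<Longrightarrow> (x, y) \<in> P i \<Longrightarrow> (y, z) \<in> P i \<Longrightarrow> (x, z) \<in> P i"
  using pref_linear[of i] unfolding strict_linear_order_on_def trans_def by blast

lemma pref_irrefl: "i \<in> I \<Longrightarrow> (x, x) \<notin> P i"
  using pref_asym by blast

lemma pref_total:
  "i \<in> I \<Longrightarrow> x \<in> alternatives C \<Longrightarrow> y \<in> alternatives C \<Longrightarrow> x \<noteq> y \<Longrightarrow>
    (x, y) \<in> P i \<or> (y, x) \<in> P i"
  using pref_linear[of i] unfolding strict_linear_order_on_def total_on_def by blast

lemma pref_SomeD: "i \<in> I \<Longrightarrow> (Some c, y) \<in> P i \<Longrightarrow> c \<in> C"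
  using pref_subset[of i] by (auto simp: alternatives_def)

text \<open>This justifies the \<open>THE\<close> in \<open>best\<close>: existence by induction on
  the finite set \<open>S\<close>, uniqueness by asymmetry. The negated form of the second claim
  also covers \<open>y = best (P i) S\<close>.\<close>

lemma best_greatest:
  assumes i: "i \<in> I" and S: "S \<noteq> {}" "S \<subseteq> alternatives C"
  shows "best (P i) S \<in> S" and "y \<in> S \<Longrightarrow> (y, best (P i) S) \<notin> P i"
proof -
  have fin: "finite S"
    using S(2) finite_colleges by (auto simp: alternatives_def intro: finite_subset)
  have "\<exists>x\<in>S. \<forall>y\<in>S. y \<noteq> x \<longrightarrow> (x, y) \<in> P i"
    using fin S
  proof (induction rule: finite_ne_induct)
    case (insert z F)
    then obtain x where x: "x \<in> F" "\<forall>y\<in>F. y \<noteq> x \<longrightarrow> (x, y) \<in> P i"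
      by auto
    have "x \<noteq> z" using x(1) insert.hyps by blast
    then consider "(x, z) \<in> P i" | "(z, x) \<in> P i"
      using pref_total[OF i, of x z] x(1) insert.prems by auto
    then show ?case
    proof cases
      case 1
      then show ?thesis using x by (intro bexI[of _ x]) auto
    next
      case 2
      then have "(z, y) \<in> P i" if "y \<in> F" for y
        using x that pref_trans[OF i] by (cases "y = x") blast+
      then show ?thesis by (intro bexI[of _ z]) auto
    qed
  qed auto
  then have "\<exists>!x. x \<in> S \<and> (\<forall>y\<in>S. y \<noteq> x \<longrightarrow> (x, y) \<in> P i)"
    using pref_asym[OF i] by metis
  from theI'[OF this] have best: "best (P i) S \<in> S"
    "\<forall>y\<in>S. y \<noteq> best (P i) S \<longrightarrow> (best (P i) S, y) \<in> P i"
    unfolding best_def by auto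
  show "best (P i) S \<in> S" by (rule best)
  show "(y, best (P i) S) \<notin> P i" if "y \<in> S"
    using best that pref_asym[OF i] pref_irrefl[OF i] by metis
qed

section \<open>Comparison of two envy-free matchings\<close>

text \<open>
  \<open>Q\<close> holds for all students under DA, but under TCDM only for the assigned ones: an unassigned
  student may have been rejected in the last round, before trying a college that has room.
\<close>

definition envy_free_on :: "('i \<Rightarrow> bool) \<Rightarrow> ('i, 'c) assignment \<Rightarrow> bool" where
  "envy_free_on Q \<mu> \<longleftrightarrow> (\<forall>i\<in>I. \<mu> i \<in> alternatives C \<and> (None, \<mu> i) \<notin> P i \<and>
    (\<forall>c. \<mu> i = Some c \<longrightarrow> \<not> full_above I q s \<mu> c (s i)) \<and>
    (Q i \<longrightarrow> (\<forall>c. (Some c, \<mu> i) \<in> P i \<longrightarrow> full_above I q s \<mu> c (s i))))"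

text \<open>If \<open>\<nu> i = Some c\<close> were preferred, \<open>Q i\<close> would make
  \<open>c\<close> full above \<open>s i\<close> in \<open>\<mu>\<close>, hence in
  \<open>\<nu>\<close> by agreement, yet \<open>c\<close> holds \<open>i\<close> there.
  \<open>None\<close> is never preferred to \<open>\<mu> i\<close>.\<close>

lemma not_preferred_if_agree_above:
  assumes \<mu>: "envy_free_on Q \<mu>" and \<nu>: "envy_free_on R \<nu>" and i: "i \<in> I" "Q i"
    and agree: "\<And>j. j \<in> I \<Longrightarrow> s i < s j \<Longrightarrow> \<mu> j = \<nu> j"
  shows "(\<nu> i, \<mu> i) \<notin> P i"
proof
  assume pref: "(\<nu> i, \<mu> i) \<in> P i"
  show False
  proof (cases "\<nu> i")
    case None
    then show False using pref \<mu> i by (auto simp: envy_free_on_def)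
  next
    case (Some c)
    then have "full_above I q s \<mu> c (s i)"
      using pref \<mu> i by (auto simp: envy_free_on_def)
    then have "full_above I q s \<nu> c (s i)"
      using full_above_cong[of I "s i" s \<mu> \<nu>] agree by blast
    then show False using Some \<nu> i by (auto simp: envy_free_on_def)
  qed
qed

text \<open>Induction on the number of students ranked above \<open>i\<close>: once the matchings
  agree on these, neither assignment of \<open>i\<close> is preferred to the other, and totality
  forces equality.\<close>

lemma envy_free_on_unique:
  assumes \<mu>: "envy_free_on Q \<mu>" and \<nu>: "envy_free_on R \<nu>"
    and "i \<in> I" "\<And>j. j \<in> I \<Longrightarrow> s i \<le> s j \<Longrightarrow> Q j \<and> R j"
  shows "\<mu> i = \<nu> i"
  using assms(3,4)
proof (induction "card {j \<in> I. s i < s j}" arbitrary: i rule: less_induct)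
  case less
  have agree: "\<mu> j = \<nu> j" if "j \<in> I" "s i < s j" for j
  proof (rule less.hyps)
    show "card {k \<in> I. s j < s k} < card {k \<in> I. s i < s k}"
      using that finite_students by (intro psubset_card_mono) auto
  qed (use that less.prems in auto)
  have "(\<nu> i, \<mu> i) \<notin> P i" "(\<mu> i, \<nu> i) \<notin> P i"
    using not_preferred_if_agree_above[OF \<mu> \<nu>, of i]
      not_preferred_if_agree_above[OF \<nu> \<mu>, of i] agree less.prems by auto
  moreover have "\<mu> i \<in> alternatives C" "\<nu> i \<in> alternatives C"
    using \<mu> \<nu> less.prems(1) by (auto simp: envy_free_on_def)
  ultimately show ?case
    using pref_total less.prems(1) by blast
qed

section \<open>Deferred acceptance\<close>

text \<open>The last two clauses work together: applications go down the preference list without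
  gaps, so a college preferred to the one now holding the student has rejected her earlier and is
  full above her score.\<close>

definition da_invariant :: "('i, 'c) da_state \<Rightarrow> bool" where
  "da_invariant st \<longleftrightarrow> (\<forall>i\<in>I. fst st i \<subseteq> acceptable C (P i) \<and>
    (\<forall>c. snd st i = Some c \<longrightarrow> c \<in> fst st i \<and> \<not> full_above I q s (snd st) c (s i)) \<and>
    (\<forall>c\<in>fst st i. snd st i \<noteq> Some c \<longrightarrow> full_above I q s (snd st) c (s i)) \<and>
    (\<forall>c\<in>fst st i. \<forall>d. (Some d, Some c) \<in> P i \<longrightarrow> d \<in> fst st i))"

text \<open>A college preferred to an acceptable one is acceptable by transitivity, so outside
  \<open>A\<close> it would beat the chosen best one.\<close>

lemma next_college_SomeD:
  assumes "i \<in> I" "next_college C (P i) A = Some c"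
  shows "c \<in> acceptable C (P i) - A"
    and "(Some d, Some c) \<in> P i \<Longrightarrow> d \<in> A"
proof -
  let ?B = "acceptable C (P i) - A"
  have ne: "?B \<noteq> {}" and c: "best (P i) (Some ` ?B) = Some c"
    using assms(2) by (auto simp: next_college_def split: if_splits)
  have sub: "Some ` ?B \<noteq> {}" "Some ` ?B \<subseteq> alternatives C"
    using ne by (auto simp: alternatives_def acceptable_def)
  show mem: "c \<in> ?B"
    using best_greatest(1)[OF assms(1) sub] c by auto
  assume d: "(Some d, Some c) \<in> P i"
  then have "d \<in> acceptable C (P i)"
    using mem pref_trans[OF assms(1)] pref_SomeD[OF assms(1)] by (auto simp: acceptable_def)
  then show "d \<in> A"
    using best_greatest(2)[OF assms(1) sub, of "Some d"] c d by auto
qed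

lemma da_invariant_step:
  assumes inv: "da_invariant st"
  shows "da_invariant (da_step I C P q s st)"
proof -
  define a where "a = da_apps C P st"
  define \<nu> where "\<nu> = tentative I q s a"
  define A where "A = (\<lambda>i. fst st i \<union> set_option (a i))"
  have step: "da_step I C P q s st = (A, \<nu>)"
    by (simp add: da_step_def a_def \<nu>_def A_def)
  have held: "a i = Some c" if "snd st i = Some c" for i c
    using that by (simp add: a_def da_apps_def)
  \<comment> \<open>Held students reapply, so \<open>c\<close> still has its applicants above
    \<open>x\<close>, and selection keeps the highest.\<close>
  have full: "full_above I q s \<nu> c x" if "full_above I q s (snd st) c x" for c x
    unfolding \<nu>_def
    by (rule full_above_tentative[OF finite_students full_above_mono[OF finite_students that]])
      (rule held)
  have app: "c \<in> acceptable C (P i) \<and> (\<forall>d. (Some d, Some c) \<in> P i \<longrightarrow> d \<in> fst st i)"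
    if i: "i \<in> I" and ai: "a i = Some c" for i c
  proof (cases "snd st i")
    case None
    then have "next_college C (P i) (fst st i) = Some c"
      using ai by (simp add: a_def da_apps_def)
    then show ?thesis
      using next_college_SomeD[OF i] by blast
  next
    case (Some d)
    then have "snd st i = Some c"
      using ai held by force
    then show ?thesis
      using inv i unfolding da_invariant_def by blast
  qed
  show ?thesis
    unfolding step da_invariant_def fst_conv snd_conv
  proof (intro ballI conjI allI impI)
    fix i assume i: "i \<in> I"
    show "A i \<subseteq> acceptable C (P i)"
      using inv i app[OF i] by (auto simp: A_def da_invariant_def)
    show "c \<in> A i" if "\<nu> i = Some c" for c
      using that tentative_SomeD by (fastforce simp: A_def \<nu>_def)
    show "\<not> full_above I q s \<nu> c (s i)" if "\<nu> i = Some c" for c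
      using that unfolding \<nu>_def by (rule not_full_above_if_held[OF finite_students])
    show "d \<in> A i" if "c \<in> A i" "(Some d, Some c) \<in> P i" for c d
      using that inv i app[OF i] by (auto simp: A_def da_invariant_def)
    show "full_above I q s \<nu> c (s i)" if c: "c \<in> A i" "\<nu> i \<noteq> Some c" for c
    \<comment> \<open>A rejection in this step is justified by its applicants, an older one by
      persistence of fullness.\<close>
    proof (cases "a i = Some c")
      case True
      then show ?thesis
        using full_above_if_rejected[of I i a c q s] c(2) i finite_students by (simp add: \<nu>_def)
    next
      case False
      then have "c \<in> fst st i" "snd st i \<noteq> Some c"
        using c(1) held by (auto simp: A_def)
      then show ?thesis
        using inv i full by (auto simp: da_invariant_def)
    qed
  qed
qed

lemma da_state_0: "da_state I C P q s 0 = (\<lambda>_. {}, \<lambda>_. None)"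
  by (simp add: da_state_def)

lemma da_state_Suc: "da_state I C P q s (Suc n) = da_step I C P q s (da_state I C P q s n)"
  by (simp add: da_state_def)

lemma da_invariant_state: "da_invariant (da_state I C P q s n)"
proof (induction n)
  case 0
  show ?case by (simp add: da_state_0 da_invariant_def)
next
  case (Suc n)
  then show ?case by (simp add: da_state_Suc da_invariant_step)
qed

text \<open>Termination measure for DA: every step with a rejection enlarges this set.\<close>

definition rejected_pairs :: "('i, 'c) da_state \<Rightarrow> ('i \<times> 'c) set" where
  "rejected_pairs st = {(i, c). i \<in> I \<and> c \<in> fst st i \<and> snd st i \<noteq> Some c}"

lemma finite_rejected_pairs:
  assumes "da_invariant st"
  shows "rejected_pairs st \<subseteq> I \<times> C" "finite (rejected_pairs st)"
proof -
  show sub: "rejected_pairs st \<subseteq> I \<times> C"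
    using assms by (fastforce simp: rejected_pairs_def da_invariant_def acceptable_def)
  show "finite (rejected_pairs st)"
    by (rule finite_subset[OF sub]) (simp add: finite_students finite_colleges)
qed

lemma rejected_pairs_step:
  assumes i: "i \<in> I" and rej: "snd (da_step I C P q s st) i \<noteq> da_apps C P st i"
  shows "rejected_pairs st \<subset> rejected_pairs (da_step I C P q s st)"
proof -
  let ?a = "da_apps C P st"
  let ?st = "da_step I C P q s st"
  \<comment> \<open>A fresh application goes to an untried college, so no old rejection is undone
    and each new one yields a new pair.\<close>
  have new: "c \<notin> fst st j" if "j \<in> I" "?a j = Some c" "snd st j \<noteq> Some c" for j c
    using that next_college_SomeD(1)[of j "fst st j" c]
    by (auto simp: da_apps_def split: option.splits)
  have held: "?a j = Some c" if "snd ?st j = Some c" for j c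
    using that tentative_SomeD by (fastforce simp: da_step_def)
  have "rejected_pairs st \<subseteq> rejected_pairs ?st"
    using new held by (fastforce simp: rejected_pairs_def da_step_def)
  moreover obtain c where c: "?a i = Some c" "snd ?st i \<noteq> Some c"
    using rej held by (metis option.exhaust)
  then have "(i, c) \<in> rejected_pairs ?st"
    using i by (simp add: rejected_pairs_def da_step_def)
  moreover have "(i, c) \<notin> rejected_pairs st"
    using new[OF i c(1)] by (auto simp: rejected_pairs_def)
  ultimately show ?thesis by blast
qed

text \<open>Otherwise every step would add a rejected pair, but all pairs lie in the finite set
  \<open>I \<times> C\<close>.\<close>

lemma da_terminates: "\<exists>n\<ge>1. da_no_rejection I C P q s n"
proof (rule ccontr)
  assume contra: "\<not> ?thesis"
  let ?R = "\<lambda>n. rejected_pairs (da_state I C P q s n)"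
  have step: "?R n \<subset> ?R (Suc n)" for n
  proof -
    have "\<not> da_no_rejection I C P q s (Suc n)" using contra by auto
    then obtain i where "i \<in> I"
      "snd (da_step I C P q s (da_state I C P q s n)) i \<noteq> da_apps C P (da_state I C P q s n) i"
      by (auto simp: da_no_rejection_def da_state_Suc)
    then show ?thesis
      unfolding da_state_Suc by (rule rejected_pairs_step)
  qed
  have "n \<le> card (?R n)" for n
  proof (induction n)
    case (Suc n)
    moreover have "card (?R n) < card (?R (Suc n))"
      by (rule psubset_card_mono[OF finite_rejected_pairs(2)[OF da_invariant_state] step])
    ultimately show ?case by linarith
  qed simp
  moreover have "card (?R n) \<le> card (I \<times> C)" for n
    by (rule card_mono[OF _ finite_rejected_pairs(1)[OF da_invariant_state]])
      (simp add: finite_students finite_colleges)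
  ultimately have "Suc (card (I \<times> C)) \<le> card (I \<times> C)"
    by (meson le_trans)
  then show False by simp
qed

lemma envy_free_on_DA: "envy_free_on (\<lambda>_. True) (DA I C P q s)"
proof -
  define n where "n = (LEAST n. n \<ge> 1 \<and> da_no_rejection I C P q s n)"
  have n: "n \<ge> 1" "da_no_rejection I C P q s n"
    using LeastI_ex[OF da_terminates] by (auto simp: n_def)
  then obtain m where m: "n = Suc m" by (cases n) auto
  define st where "st = da_state I C P q s n"
  have \<mu>: "DA I C P q s = snd st"
    by (simp add: DA_def st_def n_def)
  have inv: "da_invariant st"
    by (simp add: st_def da_invariant_state)
  \<comment> \<open>With no rejection in step \<open>n\<close>, being unassigned after it means
    having made no application in it, so no acceptable college was left untried.\<close>
  have exhausted: "acceptable C (P i) \<subseteq> fst st i" if i: "i \<in> I" "snd st i = None" for i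
  proof -
    have "da_apps C P (da_state I C P q s m) i = None"
      using n(2) i by (simp add: da_no_rejection_def st_def m)
    then have "next_college C (P i) (fst (da_state I C P q s m) i) = None"
      by (simp add: da_apps_def split: option.splits)
    \<comment> \<open>\<open>best\<close> cannot return \<open>None\<close> on a nonempty set here,
      since it picks from an image of \<open>Some\<close>.\<close>
    then have "acceptable C (P i) \<subseteq> fst (da_state I C P q s m) i"
      using best_greatest(1)[OF i(1), of "Some ` (acceptable C (P i) - fst (da_state I C P q s m) i)"]
      by (fastforce simp: next_college_def alternatives_def acceptable_def split: if_splits)
    then show ?thesis
      by (auto simp: st_def m da_state_Suc da_step_def)
  qed
  show ?thesis
    unfolding \<mu> envy_free_on_def
  proof (intro ballI conjI allI impI)
    fix i assume i: "i \<in> I"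
    have acc: "c \<in> acceptable C (P i)" if "snd st i = Some c" for c
      using that inv i unfolding da_invariant_def by blast
    show "snd st i \<in> alternatives C"
      using acc by (cases "snd st i") (auto simp: alternatives_def acceptable_def)
    show "(None, snd st i) \<notin> P i"
      using acc pref_asym[OF i] pref_irrefl[OF i]
      by (cases "snd st i") (auto simp: acceptable_def)
    show "\<not> full_above I q s (snd st) c (s i)" if "snd st i = Some c" for c
      using that inv i by (auto simp: da_invariant_def)
    show "full_above I q s (snd st) c (s i)" if c: "(Some c, snd st i) \<in> P i" for c
    proof -
      have "c \<in> fst st i"
      proof (cases "snd st i")
        case None
        then show ?thesis
          using exhausted[OF i] c pref_SomeD[OF i] by (auto simp: acceptable_def)
      next
        case (Some d)
        then show ?thesis using inv i c by (auto simp: da_invariant_def)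
      qed
      moreover have "snd st i \<noteq> Some c"
        using c pref_irrefl[OF i] by metis
      ultimately show ?thesis using inv i by (auto simp: da_invariant_def)
    qed
  qed
qed

section \<open>The time-constrained dynamic mechanism\<close>

text \<open>A held student's assignment is her application, so the conditions on \<open>a\<close>
  carry over; for a student left with \<open>None\<close> all clauses are trivial.\<close>

lemma envy_free_on_tentative:
  fixes a :: "('i, 'c) assignment"
  defines "\<nu> \<equiv> tentative I q s a"
  assumes "\<And>i. i \<in> I \<Longrightarrow> a i \<in> alternatives C \<and> (None, a i) \<notin> P i"
    and "\<And>i c. i \<in> I \<Longrightarrow> (Some c, a i) \<in> P i \<Longrightarrow> a i \<noteq> None \<Longrightarrow> full_above I q s \<nu> c (s i)"
  shows "envy_free_on (\<lambda>i. \<nu> i \<noteq> None) \<nu>"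
  unfolding envy_free_on_def
proof (intro ballI)
  fix i assume i: "i \<in> I"
  show "\<nu> i \<in> alternatives C \<and> (None, \<nu> i) \<notin> P i \<and>
    (\<forall>c. \<nu> i = Some c \<longrightarrow> \<not> full_above I q s \<nu> c (s i)) \<and>
    (\<nu> i \<noteq> None \<longrightarrow> (\<forall>c. (Some c, \<nu> i) \<in> P i \<longrightarrow> full_above I q s \<nu> c (s i)))"
  proof (cases "\<nu> i")
    case None
    then show ?thesis using pref_irrefl[OF i] by (simp add: alternatives_def)
  next
    case (Some c)
    then have "a i = Some c" unfolding \<nu>_def by (rule tentative_SomeD)
    moreover have "\<not> full_above I q s \<nu> c (s i)"
      using Some unfolding \<nu>_def by (rule not_full_above_if_held[OF finite_students])
    ultimately show ?thesis
      using Some assms(2,3)[OF i] by simp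
  qed
qed

text \<open>Induction on rounds. Held students reapply and keep the property because full colleges
  stay full; for an unassigned student, a college preferred to her next application has a cutoff
  above her score.\<close>

lemma envy_free_on_TCDM:
  assumes "T \<ge> 1"
  defines "\<mu> \<equiv> TCDM I q s T (straightforward I C P q s)"
  shows "envy_free_on (\<lambda>i. \<mu> i \<noteq> None) \<mu>"
  using assms(1) unfolding \<mu>_def
proof (induction T rule: nat_induct_at_least)
  case base
  let ?a = "\<lambda>i. straightforward I C P q s i []"
  have "envy_free_on (\<lambda>i. tentative I q s ?a i \<noteq> None) (tentative I q s ?a)"
  proof (rule envy_free_on_tentative)
    fix i assume i: "i \<in> I"
    show "?a i \<in> alternatives C \<and> (None, ?a i) \<notin> P i"
      using best_greatest[OF i, of "alternatives C"]
      by (auto simp: straightforward_def alternatives_def)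
    fix c assume "(Some c, ?a i) \<in> P i"
    \<comment> \<open>Nothing is preferred to the best of all alternatives, so the assumption is
      contradictory.\<close>
    then show "full_above I q s (tentative I q s ?a) c (s i)"
      using best_greatest(2)[OF i, of "alternatives C" "Some c"] pref_SomeD[OF i]
      by (auto simp: straightforward_def alternatives_def)
  qed
  then show ?case by (simp add: TCDM_def)
next
  case (Suc T)
  let ?\<sigma> = "straightforward I C P q s"
  define \<mu> where "\<mu> = TCDM I q s T ?\<sigma>"
  \<comment> \<open>\<open>T \<ge> 1\<close> makes the history nonempty; its head is the matching
    that the strategies read in the next round.\<close>
  obtain h where h: "tcdm_history I q s ?\<sigma> T = \<mu> # h"
    using Suc.hyps by (cases T) (auto simp: \<mu>_def TCDM_def)
  have IH: "envy_free_on (\<lambda>i. \<mu> i \<noteq> None) \<mu>"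
    using Suc.IH by (simp add: \<mu>_def)
  let ?a = "\<lambda>i. ?\<sigma> i (\<mu> # h)"
  have held: "?a i = Some c" if "\<mu> i = Some c" for i c
    using that by (simp add: straightforward_def)
  have full: "full_above I q s (tentative I q s ?a) c x" if "full_above I q s \<mu> c x" for c x
    by (rule full_above_tentative[OF finite_students full_above_mono[OF finite_students that]])
      (rule held)
  have "envy_free_on (\<lambda>i. tentative I q s ?a i \<noteq> None) (tentative I q s ?a)"
  proof (rule envy_free_on_tentative)
    fix i assume i: "i \<in> I"
    let ?S = "alternatives {c \<in> C. s i \<ge> cutoff I q s \<mu> c}"
    have S: "?S \<noteq> {}" "?S \<subseteq> alternatives C" "None \<in> ?S"
      by (auto simp: alternatives_def)
    have a: "?a i = best (P i) ?S" if "\<mu> i = None"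
      using that by (simp add: straightforward_def)
    show "?a i \<in> alternatives C \<and> (None, ?a i) \<notin> P i"
    proof (cases "\<mu> i")
      case None
      then show ?thesis
        using a best_greatest[OF i S(1,2)] S by auto
    next
      case (Some c)
      then show ?thesis
        using IH i by (auto simp: envy_free_on_def held)
    qed
    fix c assume c: "(Some c, ?a i) \<in> P i"
    \<comment> \<open>Fullness is shown in the previous matching \<open>\<mu>\<close> and then
      carried forward by \<open>full\<close>.\<close>
    have "full_above I q s \<mu> c (s i)"
    proof (cases "\<mu> i")
      case None
      then have "Some c \<notin> ?S"
        using best_greatest(2)[OF i S(1,2), of "Some c"] c a by auto
      then have "s i < cutoff I q s \<mu> c"
        using pref_SomeD[OF i c] by (auto simp: alternatives_def)
      then show ?thesis
        by (rule full_above_if_less_cutoff[OF finite_students score_pos[OF i]])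
    next
      case (Some d)
      then show ?thesis
        using IH i c by (auto simp: envy_free_on_def held)
    qed
    then show "full_above I q s (tentative I q s ?a) c (s i)" by (rule full)
  qed
  then show ?case using h by (simp add: TCDM_def)
qed

end

theorem lemma2:
  fixes I :: "'i set" and C :: "'c set"
    and P :: "'i \<Rightarrow> 'c option rel" and q :: "'c \<Rightarrow> nat" and s :: "'i \<Rightarrow> real"
    and T :: nat and i :: 'i and \<mu>_TCDM \<mu>_DA :: "('i, 'c) assignment"
  assumes "college_admissions I C P q s"
    and "T \<ge> 1"
    and "\<mu>_TCDM = TCDM I q s T (straightforward I C P q s)"
    and "\<mu>_DA = DA I C P q s"
    and "i \<in> I"
    and "(\<mu>_TCDM i, \<mu>_DA i) \<in> P i"
  shows "\<exists>j\<in>I. higher_priority s j i \<and> \<mu>_TCDM j = None"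
proof (rule ccontr)
  interpret college_admissions I C P q s by fact
  assume "\<not> ?thesis"
  then have assigned: "\<mu>_TCDM j \<noteq> None" if "j \<in> I" "s i < s j" for j
    using that by (auto simp: higher_priority_def)
  have DA: "envy_free_on (\<lambda>_. True) \<mu>_DA"
    using envy_free_on_DA assms(4) by simp
  have TCDM: "envy_free_on (\<lambda>j. \<mu>_TCDM j \<noteq> None) \<mu>_TCDM"
    using envy_free_on_TCDM[OF assms(2)] assms(3) by simp
  \<comment> \<open>Every student ranked at or above \<open>j\<close> lies above \<open>i\<close>,
    hence is assigned under TCDM, as uniqueness requires.\<close>
  have "\<mu>_DA j = \<mu>_TCDM j" if "j \<in> I" "s i < s j" for j
    using envy_free_on_unique[OF DA TCDM that(1)] assigned that by force
  \<comment> \<open>DA takes the role whose \<open>Q\<close> is constantly true, so the clause about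
    preferred colleges is available at \<open>i\<close>.\<close>
  then have "(\<mu>_TCDM i, \<mu>_DA i) \<notin> P i"
    using not_preferred_if_agree_above[OF DA TCDM assms(5)] by simp
  then show False using assms(6) by contradiction
qed

end
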